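(* For every BPPS instance, every feasible solution $(x,y,z)$ of the integer linear program $\mathrm{ILP}_{\mathrm N}$ satisfies the Minimum Classes Inequalities $$\sum_{b\in\mathcal B}y_{cb}\ \ge\ \left\lceil\frac{\sum_{i\in\mathcal I_c}w_i}{d-s_c}\right\rceil\qquad\text{for all }c\in\mathcal C.$$
   Context: Bin Packing Problem with Setups (BPPS). An instance consists of: a bin capacity $d\in\mathbb Z_{\ge1}$; items $\mathcal I=\{1,\dots,n\}$ with weights $w_i\in\mathbb Z_{\ge1}$; classes $\mathcal C=\{1,\dots,m\}$ and a partition $\{\mathcal I_1,\dots,\mathcal I_m\}$ of $\mathcal I$ into (nonempty) classes; for each class $c$ a setup weight $s_c\in\mathbb Z_{\ge0}$ and a setup cost $f_c\in\mathbb Z_{\ge0}$; a bin cost $r\in\mathbb Z_{\ge1}$. It is assumed that $w_i+s_c\le d$ for all $c\in\mathcal C$, $i\in\mathcal I_c$, and that the items cannot all be packed in a single bin, i.e. $\sum_{i\in\mathcal I}w_i+\sum_{c\in\mathcal C}s_c>d$. For $S\subseteq\mathcal I$ let $\mathcal C(S)=\{c\in\mathcal C: S\cap\mathcal I_c\neq\emptyset\}$. A packing pattern is a subset $S\subseteq\mathcal I$ with $\sum_{i\in S}w_i+\sum_{c\in\mathcal C(S)}s_c\le d$. A feasible BPPS solution is a partition $\mathcal S$ of $\mathcal I$ into (nonempty) packing patterns (used bins); its cost is $r|\mathcal S|+\sum_{S\in\mathcal S}\sum_{c\in\mathcal C(S)}f_c$, to be minimized. Let $k\in\mathbb Z_{\ge1}$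 be an upper bound on the number of bins used in any optimal BPPS solution and $\mathcal B=\{1,\dots,k\}$. The integer linear program $\mathrm{ILP}_{\mathrm N}$ is: minimize $\sum_{b\in\mathcal B}\big(r z_b+\sum_{c\in\mathcal C}f_c y_{cb}\big)$ subject to - $\sum_{b\in\mathcal B}x_{ib}=1$ for all $i\in\mathcal I$; - $\sum_{i\in\mathcal I}w_ix_{ib}+\sum_{c\in\mathcal C}s_cy_{cb}\le d\,z_b$ for all $b\in\mathcal B$; - $x_{ib}\le y_{cb}$ for all $c\in\mathcal C$, $i\in\mathcal I_c$, $b\in\mathcal B$; - $x_{ib},y_{cb},z_b\in\{0,1\}$ for all $i\in\mathcal I,c\in\mathcal C,b\in\mathcal B$. *)

theory Defs
  imports Complex_Main "HOL-Library.Disjoint_Sets"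
begin

record bpps =
  capacity :: int
  num_items :: nat
  num_classes :: nat
  weight :: "nat \<Rightarrow> int"
  class_items :: "nat \<Rightarrow> nat set"
  setup_weight :: "nat \<Rightarrow> int"
  setup_cost :: "nat \<Rightarrow> int"
  bin_cost :: int

definition items :: "bpps \<Rightarrow> nat set" where
  "items A = {1..num_items A}"

definition classes :: "bpps \<Rightarrow> nat set" where
  "classes A = {1..num_classes A}"

(* Injectivity makes the classes pairwise distinct as an indexed family;
   partition_on already excludes empty blocks. *)
definition bpps_instance :: "bpps \<Rightarrow> bool" where
  "bpps_instance A \<longleftrightarrow>
     capacity A \<ge> 1 \<and>
     (\<forall>i\<in>items A. weight A i \<ge> 1) \<and>
     partition_on (items A) (class_items A ` classes A) \<and>
     inj_on (class_items A) (classes A) \<and>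
     (\<forall>c\<in>classes A. setup_weight A c \<ge> 0 \<and> setup_cost A c \<ge> 0) \<and>
     bin_cost A \<ge> 1 \<and>
     (\<forall>c\<in>classes A. \<forall>i\<in>class_items A c. weight A i + setup_weight A c \<le> capacity A) \<and>
     (\<Sum>i\<in>items A. weight A i) + (\<Sum>c\<in>classes A. setup_weight A c) > capacity A"

definition classes_of :: "bpps \<Rightarrow> nat set \<Rightarrow> nat set" where
  "classes_of A S = {c \<in> classes A. S \<inter> class_items A c \<noteq> {}}"

definition packing_pattern :: "bpps \<Rightarrow> nat set \<Rightarrow> bool" where
  "packing_pattern A S \<longleftrightarrow>
     S \<subseteq> items A \<and>
     (\<Sum>i\<in>S. weight A i) + (\<Sum>c\<in>classes_of A S. setup_weight A c) \<le> capacity A"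

definition bpps_feasible :: "bpps \<Rightarrow> nat set set \<Rightarrow> bool" where
  "bpps_feasible A P \<longleftrightarrow> partition_on (items A) P \<and> (\<forall>S\<in>P. packing_pattern A S)"

definition bpps_cost :: "bpps \<Rightarrow> nat set set \<Rightarrow> int" where
  "bpps_cost A P =
     bin_cost A * int (card P) + (\<Sum>S\<in>P. \<Sum>c\<in>classes_of A S. setup_cost A c)"

definition bpps_optimal :: "bpps \<Rightarrow> nat set set \<Rightarrow> bool" where
  "bpps_optimal A P \<longleftrightarrow>
     bpps_feasible A P \<and> (\<forall>Q. bpps_feasible A Q \<longrightarrow> bpps_cost A P \<le> bpps_cost A Q)"

definition bin_bound :: "bpps \<Rightarrow> nat \<Rightarrow> bool" where
  "bin_bound A k \<longleftrightarrow> k \<ge> 1 \<and> (\<forall>P. bpps_optimal A P \<longrightarrow> card P \<le> k)"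

definition ilp_N_feasible ::
  "bpps \<Rightarrow> nat \<Rightarrow> (nat \<Rightarrow> nat \<Rightarrow> int) \<Rightarrow> (nat \<Rightarrow> nat \<Rightarrow> int) \<Rightarrow> (nat \<Rightarrow> int) \<Rightarrow> bool" where
  "ilp_N_feasible A k x y z \<longleftrightarrow>
     (\<forall>i\<in>items A. (\<Sum>b\<in>{1..k}. x i b) = 1) \<and>
     (\<forall>b\<in>{1..k}. (\<Sum>i\<in>items A. weight A i * x i b) + (\<Sum>c\<in>classes A. setup_weight A c * y c b)
                   \<le> capacity A * z b) \<and>
     (\<forall>c\<in>classes A. \<forall>i\<in>class_items A c. \<forall>b\<in>{1..k}. x i b \<le> y c b) \<and>
     (\<forall>i\<in>items A. \<forall>b\<in>{1..k}. x i b \<in> {0, 1}) \<and>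
     (\<forall>c\<in>classes A. \<forall>b\<in>{1..k}. y c b \<in> {0, 1}) \<and>
     (\<forall>b\<in>{1..k}. z b \<in> {0, 1})"

end

theory Submission
  imports Defs
begin

text \<open>Fix a class \<open>c\<close>. A bin holds items of \<open>c\<close> only if it also
  carries the setup of \<open>c\<close>, so these items share at most
  \<open>capacity A - setup_weight A c\<close> of its capacity; a bin without the setup holds none
  of them. Both cases are captured by the bound \<open>class_load_le\<close>, linear in
  \<open>y c b\<close>. Summed over the bins, it bounds the total weight of the class, since each
  item is assigned exactly once. The divisor is positive by
  \<open>setup_weight_less_capacity\<close>, and rounding up is sound because the sum of the
  \<open>y c b\<close> is an integer.\<close>

lemma finite_items [simp]: "finite (items A)"
  by (simp add: items_def)

lemma finite_classes [simp]: "finite (classes A)"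
  by (simp add: classes_def)

lemma class_items_subset:
  assumes "bpps_instance A" "c \<in> classes A"
  shows "class_items A c \<subseteq> items A"
  using assms by (auto simp: bpps_instance_def partition_on_def)

text \<open>A class has at least one item; its weight is at least 1 and it fits into a bin together
  with the setup.\<close>

lemma setup_weight_less_capacity:
  assumes inst: "bpps_instance A" and c: "c \<in> classes A"
  shows "setup_weight A c < capacity A"
proof -
  have "class_items A c \<noteq> {}"
    using inst c by (auto simp: bpps_instance_def partition_on_def)
  then obtain i where i: "i \<in> class_items A c"
    by blast
  then have "weight A i \<ge> 1" "weight A i + setup_weight A c \<le> capacity A"
    using inst c class_items_subset[OF inst c] by (auto simp: bpps_instance_def)
  then show ?thesis
    by linarith
qed

text \<open>Integrality of \<open>y c b\<close> leaves two cases: 0 forces every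
  \<open>x i b\<close> of the class to 0 by the linking constraint, and 1 charges the setup of
  \<open>c\<close> against the capacity.\<close>

lemma class_load_le:
  assumes inst: "bpps_instance A" and ilp: "ilp_N_feasible A k x y z"
    and c: "c \<in> classes A" and b: "b \<in> {1..k}"
  shows "(\<Sum>i\<in>class_items A c. weight A i * x i b) \<le> (capacity A - setup_weight A c) * y c b"
proof -
  have sub: "class_items A c \<subseteq> items A"
    by (rule class_items_subset[OF inst c])
  have x01: "x i b \<in> {0, 1}" if "i \<in> items A" for i
    using ilp b that by (auto simp: ilp_N_feasible_def)
  have y01: "y c' b \<in> {0, 1}" if "c' \<in> classes A" for c'
    using ilp b that by (auto simp: ilp_N_feasible_def)
  have w: "weight A i \<ge> 1" if "i \<in> items A" for i
    using inst that by (auto simp: bpps_instance_def)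
  have s: "setup_weight A c' \<ge> 0" if "c' \<in> classes A" for c'
    using inst that by (auto simp: bpps_instance_def)
  from y01[OF c] consider "y c b = 0" | "y c b = 1"
    by auto
  then show ?thesis
  proof cases
    case 1
    have "x i b = 0" if "i \<in> class_items A c" for i
    proof -
      have "x i b \<le> y c b"
        using ilp b c that by (auto simp: ilp_N_feasible_def)
      with 1 x01[of i] sub that show ?thesis
        by auto
    qed
    with 1 show ?thesis
      by simp
  next
    case 2
    have "(\<Sum>i\<in>class_items A c. weight A i * x i b) \<le> (\<Sum>i\<in>items A. weight A i * x i b)"
    proof (rule sum_mono2[OF finite_items sub])
      fix i assume "i \<in> items A - class_items A c"
      with x01[of i] w[of i] show "0 \<le> weight A i * x i b"
        by auto
    qed
    moreover have "setup_weight A c * y c b \<le> (\<Sum>c'\<in>classes A. setup_weight A c' * y c' b)"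
    proof (rule member_le_sum[OF c _ finite_classes])
      fix c' assume "c' \<in> classes A - {c}"
      with y01[of c'] s[of c'] show "0 \<le> setup_weight A c' * y c' b"
        by auto
    qed
    moreover have "(\<Sum>i\<in>items A. weight A i * x i b) + (\<Sum>c\<in>classes A. setup_weight A c * y c b)
        \<le> capacity A * z b"
      using ilp b by (auto simp: ilp_N_feasible_def)
    moreover have "capacity A * z b \<le> capacity A"
    proof -
      have "z b \<in> {0, 1}" "capacity A \<ge> 1"
        using ilp b inst by (auto simp: ilp_N_feasible_def bpps_instance_def)
      then show ?thesis
        by auto
    qed
    ultimately show ?thesis
      using 2 by simp
  qed
qed

theorem proposition3:
  fixes A :: bpps and k :: nat
    and x y :: "nat \<Rightarrow> nat \<Rightarrow> int" and z :: "nat \<Rightarrow> int"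
  assumes "bpps_instance A"
    and "bin_bound A k"
    and "ilp_N_feasible A k x y z"
  shows "\<forall>c\<in>classes A.
    (\<Sum>b\<in>{1..k}. y c b) \<ge>
      \<lceil>real_of_int (\<Sum>i\<in>class_items A c. weight A i) / real_of_int (capacity A - setup_weight A c)\<rceil>"
proof
  fix c assume c: "c \<in> classes A"
  let ?W = "\<Sum>i\<in>class_items A c. weight A i"
  let ?D = "capacity A - setup_weight A c"
  let ?Y = "\<Sum>b\<in>{1..k}. y c b"
  have assigned: "(\<Sum>b\<in>{1..k}. x i b) = 1" if "i \<in> class_items A c" for i
    using assms(3) class_items_subset[OF assms(1) c] that by (auto simp: ilp_N_feasible_def)
  \<comment> \<open>Each weight is multiplied by 1, written as the assignment sum, so that
    exchanging the sums splits the class weight into loads per bin.\<close>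
  have "?W = (\<Sum>i\<in>class_items A c. weight A i * (\<Sum>b\<in>{1..k}. x i b))"
    by (rule sum.cong) (simp_all only: assigned mult_1_right)
  also have "\<dots> = (\<Sum>b\<in>{1..k}. \<Sum>i\<in>class_items A c. weight A i * x i b)"
    unfolding sum_distrib_left by (rule sum.swap)
  also have "\<dots> \<le> (\<Sum>b\<in>{1..k}. ?D * y c b)"
    by (rule sum_mono) (rule class_load_le[OF assms(1,3) c])
  also have "\<dots> = ?Y * ?D"
    by (simp add: sum_distrib_left mult.commute)
  finally have "real_of_int ?W \<le> real_of_int ?Y * real_of_int ?D"
    unfolding of_int_mult[symmetric] of_int_le_iff .
  moreover have "0 < real_of_int ?D"
    using setup_weight_less_capacity[OF assms(1) c] by simp
  ultimately have "real_of_int ?W / real_of_int ?D \<le> real_of_int ?Y"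
    by (simp only: pos_divide_le_eq)
  \<comment> \<open>An integer above a real number is also above its ceiling.\<close>
  then show "\<lceil>real_of_int ?W / real_of_int ?D\<rceil> \<le> ?Y"
    by (simp only: ceiling_le_iff)
qed

end
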